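(* Let $\mathfrak r\ge3$ and $P\in\mathcal{GMC}_{\mathfrak r}$, and consider the matrix $P\Lambda$ on $\llbracket0,\mathfrak r\rrbracket$, where $\Lambda=(H_S^TD_\pi)^{-1}$, $H_S$ is the matrix on $\llbracket0,\mathfrak r\rrbracket$ with $H_S(x,y)=\mathbf 1_{\{x\le y\}}$, and $D_\pi$ is the diagonal matrix of $\pi$. Then $$(\Lambda^{-1})^{\llbracket0,\mathfrak r-1\rrbracket}\,(P\Lambda)^{\llbracket0,\mathfrak r-1\rrbracket}\in\mathcal S(Q)$$ with $Q$ being an irreducible birth-death transition kernel on $\llbracket0,\mathfrak r-1\rrbracket$.
   Context: $\llbracket a,b\rrbracket=\{a,a+1,\dots,b\}$. For a square matrix $M$ on $\llbracket0,\mathfrak r\rrbracket$, $M^{\llbracket0,\mathfrak r-1\rrbracket}$ is its principal submatrix on $\llbracket0,\mathfrak r-1\rrbracket$. For a Markov transition matrix $P$ with stationary distribution $\pi>0$, the time-reversal $\widehat P$ is given by $\pi(x)\widehat P(x,y)=\pi(y)P(y,x)$, and $\widehat{\mathbb P}_x$ is the law of the chain $(X_n)$ with transition matrix $\widehat P$ started at $x$. The class $\mathcal{GMC}_{\mathfrak r}$, for some $\mathfrak r\ge3$: $P\in\mathcal{GMC}_{\mathfrak r}$ if $P$ is a Markov transition kernel on $\mathcal X=\llbracket0,\mathfrak r\rrbracket$ and for every $x\in\llbracket0,\mathfrak r-1\rrbracket$ its time-reversal satisfies: (1) $\widehat{\mathbb P}_{x+1}(X_1\le x)\le\widehat{\mathbb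 P}_x(X_1\le x)$; (2) $\widehat{\mathbb P}_{x+1}(X_1\le x-1)<\widehat{\mathbb P}_x(X_1\le x-1)$ for $x\ne0$; (3) $\widehat{\mathbb P}_{x+1}(X_1\le x+1)<\widehat{\mathbb P}_x(X_1\le x+1)$ for $x\ne\mathfrak r-1$; (4) $\widehat{\mathbb P}_{x+1}(X_1\le x-k)=\widehat{\mathbb P}_x(X_1\le x-k)$ for $k\in\llbracket2,x\rrbracket$; (5) $\widehat{\mathbb P}_{x+1}(X_1\le x+k)=\widehat{\mathbb P}_x(X_1\le x+k)$ for $k\in\llbracket2,\mathfrak r-1-x\rrbracket$. For a normal Markov transition kernel $Q$ on a countable state space, with reference measure $\pi_Q$ (normal means that $Q$ commutes with its adjoint in $\ell^2(\pi_Q)$; birth-death kernels are reversible, hence normal), the similarity orbit $\mathcal S(Q)$ is the set of Markov transition kernels $R$ on the same state space, with reference measure $\pi_R$, for which there is a bounded linear operator $B:\ell^2(\pi_Q)\to\ell^2(\pi_R)$ with bounded inverse such that $RB=BQ$. A birth-death kernel is one whose only possible transitions from $x$ are to $x-1$, $x$, $x+1$.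
   Formalization: The kernels Q and R in the similarity orbit may have row sums at most 1 (killing allowed), with positive excessive reference measures; with row sums equal to 1 the claim fails for every P in the class, since row 0 of the matrix then sums to less than 1. *)

theory Defs
  imports
    "HOL-Analysis.Infinite_Sum"
    "Jordan_Normal_Form.Gauss_Jordan_Elimination"
    "Jordan_Normal_Form.DL_Submatrix"
begin

text \<open>
  A kernel on a countable state space \<open>X\<close> is a function \<open>'a \<Rightarrow> 'a \<Rightarrow> real\<close>, of which only the
  values on \<open>X \<times> X\<close> matter.

  The kernel \<open>P\<close> of the class \<open>GMC\<close> is stochastic. The kernels related by the similarity orbit
  are only required to have row sums at most 1, i.e. killing is allowed. This is forced: for
  \<open>P\<close> in \<open>GMC\<close>, row \<open>x\<close> of the matrix considered in the theorem sums to
  \<open>\<P>\<^sub>0(X\<^sub>1 \<le> x) - \<P>\<^sub>\<r>(X\<^sub>1 \<le> x)\<close> for the time-reversal. Row sums all equal to 1 would make 0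
  absorbing for the time-reversal; as \<open>\<pi>\<close> is positive and stationary, no state could then enter 0,
  whereas condition (2) at \<open>x = 1\<close> makes the transition from 1 to 0 possible.
\<close>

definition markov_kernel :: "'a set \<Rightarrow> ('a \<Rightarrow> 'a \<Rightarrow> real) \<Rightarrow> bool" where
  "markov_kernel X K \<longleftrightarrow>
     (\<forall>x\<in>X. (\<forall>y\<in>X. 0 \<le> K x y) \<and> (K x has_sum 1) X)"

definition transition_kernel :: "'a set \<Rightarrow> ('a \<Rightarrow> 'a \<Rightarrow> real) \<Rightarrow> bool" where
  "transition_kernel X K \<longleftrightarrow>
     (\<forall>x\<in>X. (\<forall>y\<in>X. 0 \<le> K x y) \<and> K x summable_on X \<and> infsum (K x) X \<le> 1)"

definition stationary_distribution :: "'a set \<Rightarrow> ('a \<Rightarrow> 'a \<Rightarrow> real) \<Rightarrow> ('a \<Rightarrow> real) \<Rightarrow> bool" where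
  "stationary_distribution X K \<pi> \<longleftrightarrow>
     (\<forall>x\<in>X. 0 \<le> \<pi> x) \<and> (\<pi> has_sum 1) X \<and>
     (\<forall>y\<in>X. ((\<lambda>x. \<pi> x * K x y) has_sum \<pi> y) X)"

text \<open>
  A reference measure is a positive excessive measure. This is what makes a transition kernel act
  as a contraction on the weighted \<open>\<ell>\<^sup>2\<close> space; for a stochastic kernel on a finite state space,
  excessive is the same as stationary.
\<close>

definition reference_measure :: "'a set \<Rightarrow> ('a \<Rightarrow> 'a \<Rightarrow> real) \<Rightarrow> ('a \<Rightarrow> real) \<Rightarrow> bool" where
  "reference_measure X K \<pi> \<longleftrightarrow>
     (\<forall>x\<in>X. 0 < \<pi> x) \<and>
     (\<forall>y\<in>X. (\<lambda>x. \<pi> x * K x y) summable_on X \<and> (\<Sum>\<^sub>\<infinity>x\<in>X. \<pi> x * K x y) \<le> \<pi> y)"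

definition time_reversal :: "('a \<Rightarrow> real) \<Rightarrow> ('a \<Rightarrow> 'a \<Rightarrow> real) \<Rightarrow> 'a \<Rightarrow> 'a \<Rightarrow> real" where
  "time_reversal \<pi> P x y = \<pi> y * P y x / \<pi> x"

text \<open>The probability that the chain on \<open>X\<close> with kernel \<open>K\<close> started at \<open>x\<close> is in \<open>A\<close> at time 1.\<close>

definition step_prob :: "'a set \<Rightarrow> ('a \<Rightarrow> 'a \<Rightarrow> real) \<Rightarrow> 'a \<Rightarrow> 'a set \<Rightarrow> real" where
  "step_prob X K x A = (\<Sum>\<^sub>\<infinity>y\<in>X \<inter> A. K x y)"

text \<open>
  The stationary distribution is a parameter, since \<open>P\<close> is not assumed irreducible. No natural
  number subtraction below truncates, because of the guards.
\<close>

definition GMC :: "nat \<Rightarrow> (nat \<Rightarrow> real) \<Rightarrow> (nat \<Rightarrow> nat \<Rightarrow> real) \<Rightarrow> bool" where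
  "GMC r \<pi> P \<longleftrightarrow>
     3 \<le> r \<and>
     markov_kernel {0..r} P \<and>
     stationary_distribution {0..r} P \<pi> \<and> (\<forall>x\<in>{0..r}. 0 < \<pi> x) \<and>
     (let F = (\<lambda>x y. step_prob {0..r} (time_reversal \<pi> P) x {..y}) in
      \<forall>x\<in>{0..r-1}.
        F (x+1) x \<le> F x x \<and>
        (x \<noteq> 0 \<longrightarrow> F (x+1) (x-1) < F x (x-1)) \<and>
        (x \<noteq> r-1 \<longrightarrow> F (x+1) (x+1) < F x (x+1)) \<and>
        (\<forall>k\<in>{2..x}. F (x+1) (x-k) = F x (x-k)) \<and>
        (\<forall>k\<in>{2..r-1-x}. F (x+1) (x+k) = F x (x+k)))"


subsection \<open>Weighted \<open>\<ell>\<^sup>2\<close> spaces and similarity orbits\<close>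

text \<open>Functions on \<open>X\<close> are represented by functions vanishing outside \<open>X\<close>.\<close>

definition ell2 :: "'a set \<Rightarrow> ('a \<Rightarrow> real) \<Rightarrow> ('a \<Rightarrow> real) set" where
  "ell2 X \<pi> = {f. (\<forall>x. x \<notin> X \<longrightarrow> f x = 0) \<and> (\<lambda>x. \<pi> x * (f x)\<^sup>2) summable_on X}"

definition ell2_inner :: "'a set \<Rightarrow> ('a \<Rightarrow> real) \<Rightarrow> ('a \<Rightarrow> real) \<Rightarrow> ('a \<Rightarrow> real) \<Rightarrow> real" where
  "ell2_inner X \<pi> f g = (\<Sum>\<^sub>\<infinity>x\<in>X. \<pi> x * f x * g x)"

definition ell2_norm :: "'a set \<Rightarrow> ('a \<Rightarrow> real) \<Rightarrow> ('a \<Rightarrow> real) \<Rightarrow> real" where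
  "ell2_norm X \<pi> f = sqrt (ell2_inner X \<pi> f f)"

definition bounded_operator ::
  "'a set \<Rightarrow> ('a \<Rightarrow> real) \<Rightarrow> 'b set \<Rightarrow> ('b \<Rightarrow> real) \<Rightarrow> (('a \<Rightarrow> real) \<Rightarrow> ('b \<Rightarrow> real)) \<Rightarrow> bool" where
  "bounded_operator X \<pi> Y \<rho> B \<longleftrightarrow>
     B \<in> ell2 X \<pi> \<rightarrow> ell2 Y \<rho> \<and>
     (\<forall>f\<in>ell2 X \<pi>. \<forall>g\<in>ell2 X \<pi>. B (\<lambda>x. f x + g x) = (\<lambda>y. B f y + B g y)) \<and>
     (\<forall>c. \<forall>f\<in>ell2 X \<pi>. B (\<lambda>x. c * f x) = (\<lambda>y. c * B f y)) \<and>
     (\<exists>C. \<forall>f\<in>ell2 X \<pi>. ell2_norm Y \<rho> (B f) \<le> C * ell2_norm X \<pi> f)"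

definition kernel_operator :: "'a set \<Rightarrow> ('a \<Rightarrow> 'a \<Rightarrow> real) \<Rightarrow> ('a \<Rightarrow> real) \<Rightarrow> 'a \<Rightarrow> real" where
  "kernel_operator X K f = (\<lambda>x. if x \<in> X then (\<Sum>\<^sub>\<infinity>y\<in>X. K x y * f y) else 0)"

definition normal_kernel :: "'a set \<Rightarrow> ('a \<Rightarrow> 'a \<Rightarrow> real) \<Rightarrow> ('a \<Rightarrow> real) \<Rightarrow> bool" where
  "normal_kernel X Q \<pi> \<longleftrightarrow>
     transition_kernel X Q \<and> reference_measure X Q \<pi> \<and>
     (\<exists>A. bounded_operator X \<pi> X \<pi> A \<and>
          (\<forall>f\<in>ell2 X \<pi>. \<forall>g\<in>ell2 X \<pi>.
             ell2_inner X \<pi> (kernel_operator X Q f) g = ell2_inner X \<pi> f (A g)) \<and>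
          (\<forall>f\<in>ell2 X \<pi>. kernel_operator X Q (A f) = A (kernel_operator X Q f)))"

definition similarity_orbit ::
  "'a set \<Rightarrow> ('a \<Rightarrow> 'a \<Rightarrow> real) \<Rightarrow> ('a \<Rightarrow> real) \<Rightarrow> ('a \<Rightarrow> 'a \<Rightarrow> real) set" where
  "similarity_orbit X Q \<pi>Q =
     {R. transition_kernel X R \<and>
         (\<exists>\<pi>R B B'. reference_measure X R \<pi>R \<and>
            bounded_operator X \<pi>Q X \<pi>R B \<and>
            bounded_operator X \<pi>R X \<pi>Q B' \<and>
            (\<forall>f\<in>ell2 X \<pi>Q. B' (B f) = f) \<and>
            (\<forall>g\<in>ell2 X \<pi>R. B (B' g) = g) \<and>
            (\<forall>f\<in>ell2 X \<pi>Q. kernel_operator X R (B f) = B (kernel_operator X Q f)))}"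

definition irreducible_kernel :: "'a set \<Rightarrow> ('a \<Rightarrow> 'a \<Rightarrow> real) \<Rightarrow> bool" where
  "irreducible_kernel X K \<longleftrightarrow>
     (\<forall>x\<in>X. \<forall>y\<in>X. (x, y) \<in> {(u, v). u \<in> X \<and> v \<in> X \<and> 0 < K u v}\<^sup>*)"

definition birth_death_kernel :: "nat set \<Rightarrow> (nat \<Rightarrow> nat \<Rightarrow> real) \<Rightarrow> bool" where
  "birth_death_kernel X K \<longleftrightarrow>
     transition_kernel X K \<and>
     (\<forall>x\<in>X. \<forall>y\<in>X. K x y \<noteq> 0 \<longrightarrow> y + 1 = x \<or> y = x \<or> y = x + 1)"


subsection \<open>Matrices\<close>

definition kernel_mat :: "nat \<Rightarrow> (nat \<Rightarrow> nat \<Rightarrow> real) \<Rightarrow> real mat" where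
  "kernel_mat r K = mat (r+1) (r+1) (\<lambda>(x, y). K x y)"

definition mat_kernel :: "real mat \<Rightarrow> nat \<Rightarrow> nat \<Rightarrow> real" where
  "mat_kernel M x y = M $$ (x, y)"

text \<open>The inverse of an invertible square matrix (unspecified for other matrices).\<close>

definition mat_inv :: "real mat \<Rightarrow> real mat" where
  "mat_inv A = the (mat_inverse A)"

definition H\<^sub>S :: "nat \<Rightarrow> real mat" where
  "H\<^sub>S r = mat (r+1) (r+1) (\<lambda>(x, y). if x \<le> y then 1 else 0)"

definition Lambda :: "nat \<Rightarrow> (nat \<Rightarrow> real) \<Rightarrow> real mat" where
  "Lambda r \<pi> = mat_inv (transpose_mat (H\<^sub>S r) * mat_diag (r+1) \<pi>)"

definition principal_submatrix :: "real mat \<Rightarrow> nat set \<Rightarrow> real mat" where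
  "principal_submatrix M I = submatrix M I I"

end

theory Submission
  imports Defs "HOL-Analysis.Convex" "Jordan_Normal_Form.Determinant"
begin

text \<open>
  Write \<open>F x y\<close> for the probability that the time-reversal started at \<open>x\<close> is in \<open>{0..y}\<close> at time 1.
  The matrix \<open>\<Lambda>\<^sup>-\<^sup>1\<close> sums against \<open>\<pi>\<close> over initial segments, and \<open>\<Lambda>\<close> takes differences of
  consecutive columns divided by \<open>\<pi>\<close>. Since \<open>\<pi> z P(z, y) / \<pi> y\<close> is the time-reversal at
  \<open>(y, z)\<close>, the entry \<open>(x, y)\<close> of the matrix of the theorem is \<open>F y x - F (y + 1) x\<close>
  (lemma \<open>truncated_conjugate_entry\<close>). Read in this way, the five conditions defining the class
  say that this matrix has a nonnegative diagonal, positive entries next to the diagonal, and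
  zeros elsewhere. A row sum telescopes to \<open>F 0 x - F r x \<le> 1\<close>. Hence the matrix is itself an
  irreducible birth-death kernel \<open>Q\<close>, with killing.

  Such a kernel is reversible with respect to the usual product of ratios of birth and death
  rates. Detailed balance makes this measure excessive and the operator of \<open>Q\<close> self-adjoint, so
  \<open>Q\<close> is normal, and it lies in its own similarity orbit by means of the identity operator.
\<close>

section \<open>Weighted spaces over a finite set\<close>

lemma ell2_finite:
  assumes "finite X"
  shows "ell2 X \<pi> = {f. \<forall>x. x \<notin> X \<longrightarrow> f x = 0}"
  using assms by (auto simp: ell2_def intro: summable_on_finite)

lemma bounded_operator_id: "bounded_operator X \<pi> X \<pi> (\<lambda>f. f)"
  unfolding bounded_operator_def by (auto intro!: exI[of _ 1])

text \<open>
  The bound is the Hilbert-Schmidt norm; splitting each term as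
  \<open>(K x y / sqrt (\<pi> y)) * (sqrt (\<pi> y) * f y)\<close> lets Cauchy-Schwarz produce the weighted norm of \<open>f\<close>.
\<close>

lemma bounded_operator_kernel_operator:
  assumes fin: "finite X" and pos: "\<And>x. x \<in> X \<Longrightarrow> 0 < \<pi> x"
  shows "bounded_operator X \<pi> X \<pi> (kernel_operator X K)"
proof -
  define C where "C = (\<Sum>x\<in>X. \<pi> x * (\<Sum>y\<in>X. (K x y / sqrt (\<pi> y))\<^sup>2))"
  have "ell2_norm X \<pi> (kernel_operator X K f) \<le> sqrt C * ell2_norm X \<pi> f" for f
  proof -
    define N where "N = (\<Sum>y\<in>X. (sqrt (\<pi> y) * f y)\<^sup>2)"
    have N: "ell2_inner X \<pi> f f = N"
      unfolding ell2_inner_def N_def infsum_finite[OF fin]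
      by (rule sum.cong) (auto simp: power_mult_distrib less_imp_le[OF pos] power2_eq_square)
    have row: "(\<Sum>y\<in>X. K x y * f y)\<^sup>2 \<le> (\<Sum>y\<in>X. (K x y / sqrt (\<pi> y))\<^sup>2) * N" for x
    proof -
      have "(\<Sum>y\<in>X. K x y * f y) = (\<Sum>y\<in>X. (K x y / sqrt (\<pi> y)) * (sqrt (\<pi> y) * f y))"
        using pos by (intro sum.cong) (auto simp: less_imp_neq[symmetric])
      then show ?thesis
        unfolding N_def by (simp only: Cauchy_Schwarz_ineq_sum)
    qed
    have "ell2_inner X \<pi> (kernel_operator X K f) (kernel_operator X K f)
        = (\<Sum>x\<in>X. \<pi> x * (\<Sum>y\<in>X. K x y * f y)\<^sup>2)"
      unfolding ell2_inner_def infsum_finite[OF fin]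
      by (rule sum.cong) (auto simp: kernel_operator_def infsum_finite[OF fin] power2_eq_square)
    also have "\<dots> \<le> (\<Sum>x\<in>X. \<pi> x * ((\<Sum>y\<in>X. (K x y / sqrt (\<pi> y))\<^sup>2) * N))"
      using row pos by (intro sum_mono mult_left_mono) (auto simp: less_imp_le)
    also have "\<dots> = C * N"
      by (simp add: C_def sum_distrib_right mult.assoc)
    finally show ?thesis
      unfolding ell2_norm_def N by (metis real_sqrt_le_mono real_sqrt_mult)
  qed
  then have "\<exists>C. \<forall>f\<in>ell2 X \<pi>. ell2_norm X \<pi> (kernel_operator X K f) \<le> C * ell2_norm X \<pi> f"
    by blast
  then show ?thesis
    unfolding bounded_operator_def ell2_finite[OF fin] kernel_operator_def infsum_finite[OF fin]
    by (auto simp: fun_eq_iff algebra_simps sum.distrib sum_distrib_left)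
qed

section \<open>Reversible kernels\<close>

definition detailed_balance :: "'a set \<Rightarrow> ('a \<Rightarrow> 'a \<Rightarrow> real) \<Rightarrow> ('a \<Rightarrow> real) \<Rightarrow> bool" where
  "detailed_balance X K \<mu> \<longleftrightarrow> (\<forall>x\<in>X. \<forall>y\<in>X. \<mu> x * K x y = \<mu> y * K y x)"

text \<open>By detailed balance, the mass entering \<open>y\<close> is \<open>\<mu> y\<close> times the sum of row \<open>y\<close>, at most 1.\<close>

lemma reference_measure_if_detailed_balance:
  assumes fin: "finite X" and pos: "\<And>x. x \<in> X \<Longrightarrow> 0 < \<mu> x"
    and K: "transition_kernel X K" and db: "detailed_balance X K \<mu>"
  shows "reference_measure X K \<mu>"
proof -
  have "(\<Sum>x\<in>X. \<mu> x * K x y) \<le> \<mu> y" if y: "y \<in> X" for y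
  proof -
    have "(\<Sum>x\<in>X. \<mu> x * K x y) = \<mu> y * (\<Sum>x\<in>X. K y x)"
      unfolding sum_distrib_left
      using db y by (intro sum.cong) (auto simp: detailed_balance_def)
    also have "\<dots> \<le> \<mu> y * 1"
      using K y pos[OF y] fin by (intro mult_left_mono) (auto simp: transition_kernel_def)
    finally show ?thesis by simp
  qed
  then show ?thesis
    using pos fin by (auto simp: reference_measure_def intro: summable_on_finite)
qed

lemma kernel_operator_self_adjoint:
  assumes fin: "finite X" and db: "detailed_balance X K \<mu>"
  shows "ell2_inner X \<mu> (kernel_operator X K f) g = ell2_inner X \<mu> f (kernel_operator X K g)"
proof -
  have "ell2_inner X \<mu> (kernel_operator X K f) g = (\<Sum>x\<in>X. \<Sum>y\<in>X. \<mu> x * K x y * f y * g x)"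
    by (simp add: ell2_inner_def kernel_operator_def infsum_finite[OF fin]
        sum_distrib_left sum_distrib_right mult.assoc)
  also have "\<dots> = (\<Sum>y\<in>X. \<Sum>x\<in>X. \<mu> x * K x y * f y * g x)"
    by (rule sum.swap)
  also have "\<dots> = (\<Sum>y\<in>X. \<Sum>x\<in>X. \<mu> y * K y x * f y * g x)"
    using db by (intro sum.cong refl) (simp add: detailed_balance_def)
  also have "\<dots> = ell2_inner X \<mu> f (kernel_operator X K g)"
    by (simp add: ell2_inner_def kernel_operator_def infsum_finite[OF fin]
        sum_distrib_left sum_distrib_right mult_ac)
  finally show ?thesis .
qed

lemma normal_kernel_if_detailed_balance:
  assumes "finite X" and "\<And>x. x \<in> X \<Longrightarrow> 0 < \<mu> x"
    and "transition_kernel X K" and "detailed_balance X K \<mu>"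
  shows "normal_kernel X K \<mu>"
  unfolding normal_kernel_def
proof (intro conjI exI[of _ "kernel_operator X K"] ballI)
  show "reference_measure X K \<mu>"
    using reference_measure_if_detailed_balance[OF assms] .
  show "bounded_operator X \<mu> X \<mu> (kernel_operator X K)"
    using bounded_operator_kernel_operator[OF assms(1,2)] .
qed (use assms kernel_operator_self_adjoint in auto)

lemma similarity_orbit_refl:
  assumes "transition_kernel X K" and "reference_measure X K \<mu>"
  shows "K \<in> similarity_orbit X K \<mu>"
  unfolding similarity_orbit_def
  using assms bounded_operator_id[of X \<mu>] by (intro CollectI conjI exI[of _ \<mu>] exI[of _ "\<lambda>f. f"]) auto

section \<open>Tridiagonal kernels\<close>

definition birth_death_measure :: "(nat \<Rightarrow> nat \<Rightarrow> real) \<Rightarrow> nat \<Rightarrow> real" where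
  "birth_death_measure K x = (\<Prod>k<x. K k (k+1) / K (k+1) k)"

lemma birth_death_measure_pos:
  assumes "\<And>k. k < n \<Longrightarrow> 0 < K k (k+1)" and "\<And>k. k < n \<Longrightarrow> 0 < K (k+1) k" and "x \<le> n"
  shows "0 < birth_death_measure K x"
  unfolding birth_death_measure_def using assms by (intro prod_pos) auto

lemma detailed_balance_birth_death_measure:
  assumes bd: "birth_death_kernel {0..n} K" and down: "\<And>k. k < n \<Longrightarrow> 0 < K (k+1) k"
  shows "detailed_balance {0..n} K (birth_death_measure K)"
proof -
  let ?\<mu> = "birth_death_measure K"
  have edge: "?\<mu> x * K x (x+1) = ?\<mu> (x+1) * K (x+1) x" if "x < n" for x
    using down[OF that] by (simp add: birth_death_measure_def)
  have "?\<mu> x * K x y = ?\<mu> y * K y x" if "x \<le> n" "y \<le> n" for x y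
  proof -
    consider "y = x" | "y = x + 1" | "x = y + 1" | "K x y = 0" "K y x = 0"
      using bd \<open>x \<le> n\<close> \<open>y \<le> n\<close> unfolding birth_death_kernel_def by fastforce
    then show ?thesis
      using edge[of x] edge[of y] \<open>x \<le> n\<close> \<open>y \<le> n\<close> by cases auto
  qed
  then show ?thesis by (simp add: detailed_balance_def)
qed

lemma irreducible_if_neighbours_positive:
  fixes K :: "nat \<Rightarrow> nat \<Rightarrow> real"
  assumes up: "\<And>k. k < n \<Longrightarrow> 0 < K k (k+1)" and down: "\<And>k. k < n \<Longrightarrow> 0 < K (k+1) k"
  shows "irreducible_kernel {0..n} K"
proof -
  let ?R = "{(u, v). u \<in> {0..n} \<and> v \<in> {0..n} \<and> 0 < K u v}"
  have zero_to: "(0, x) \<in> ?R\<^sup>*" if "x \<le> n" for x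
    using that
  proof (induction x)
    case (Suc x)
    then have "(x, Suc x) \<in> ?R" using up[of x] by auto
    with Suc show ?case by (meson Suc_leD rtrancl.rtrancl_into_rtrancl)
  qed simp
  have to_zero: "(x, 0) \<in> ?R\<^sup>*" if "x \<le> n" for x
    using that
  proof (induction x)
    case (Suc x)
    then have "(Suc x, x) \<in> ?R" using down[of x] by auto
    with Suc show ?case by (meson Suc_leD converse_rtrancl_into_rtrancl)
  qed simp
  show ?thesis
    unfolding irreducible_kernel_def using zero_to to_zero by (meson atLeastAtMost_iff rtrancl_trans)
qed

section \<open>The matrix as differences of distribution functions of the time-reversal\<close>

lemma mat_inv_eqI:
  assumes A: "A \<in> carrier_mat n n" and B: "B \<in> carrier_mat n n" and AB: "A * B = 1\<^sub>m n"
  shows "mat_inv A = B"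
proof -
  have BA: "B * A = 1\<^sub>m n"
    using mat_mult_left_right_inverse[OF A B AB] .
  have "A \<in> Units (ring_mat TYPE(real) n ())"
    unfolding Units_def ring_mat_simps using A B AB BA by blast
  then obtain C where C: "mat_inverse A = Some C"
    using mat_inverse(1)[OF A] by fastforce
  then have "A * C = 1\<^sub>m n" "C \<in> carrier_mat n n"
    using mat_inverse(2)[OF A C] by auto
  then have "C = B * A * C" using BA by simp
  also have "\<dots> = B"
    using A B \<open>A * C = 1\<^sub>m n\<close> \<open>C \<in> carrier_mat n n\<close> by (simp add: assoc_mult_mat[of _ n n _ n _ n])
  finally show ?thesis using C by (simp add: mat_inv_def)
qed

definition weighted_sums_mat :: "nat \<Rightarrow> (nat \<Rightarrow> real) \<Rightarrow> real mat" where
  "weighted_sums_mat r \<pi> = mat (r+1) (r+1) (\<lambda>(x, y). if y \<le> x then \<pi> y else 0)"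

definition weighted_differences_mat :: "nat \<Rightarrow> (nat \<Rightarrow> real) \<Rightarrow> real mat" where
  "weighted_differences_mat r \<pi> =
     mat (r+1) (r+1) (\<lambda>(x, y). (of_bool (x = y) - of_bool (x = y+1)) / \<pi> x)"

lemma weighted_mats_carrier:
  "weighted_sums_mat r \<pi> \<in> carrier_mat (r+1) (r+1)"
  "weighted_differences_mat r \<pi> \<in> carrier_mat (r+1) (r+1)"
  by (simp_all add: weighted_sums_mat_def weighted_differences_mat_def)

lemma sums_mult_differences:
  assumes pos: "\<And>x. x \<le> r \<Longrightarrow> 0 < \<pi> x"
  shows "weighted_sums_mat r \<pi> * weighted_differences_mat r \<pi> = 1\<^sub>m (r+1)"
proof (rule eq_matI)
  fix x y assume "x < dim_row (1\<^sub>m (r+1) :: real mat)" "y < dim_col (1\<^sub>m (r+1) :: real mat)"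
  then have xy: "x < r+1" "y < r+1" by auto
  have "(weighted_sums_mat r \<pi> * weighted_differences_mat r \<pi>) $$ (x, y)
      = (\<Sum>z = 0..<r+1. (if z \<le> x then \<pi> z else 0) * ((of_bool (z = y) - of_bool (z = y+1)) / \<pi> z))"
    using xy by (simp add: weighted_sums_mat_def weighted_differences_mat_def scalar_prod_def)
  also have "\<dots> = (\<Sum>z = 0..<r+1. (if z = y then of_bool (y \<le> x) else 0)
                                - (if z = y+1 then of_bool (y+1 \<le> x) else 0))"
    using pos by (intro sum.cong) (auto simp: less_imp_neq[symmetric])
  also have "\<dots> = of_bool (x = y)"
    using xy by (auto simp: sum_subtractf)
  finally show "(weighted_sums_mat r \<pi> * weighted_differences_mat r \<pi>) $$ (x, y) = 1\<^sub>m (r+1) $$ (x, y)"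
    using xy by simp
qed (simp_all add: weighted_sums_mat_def weighted_differences_mat_def)

lemma Lambda_eq:
  assumes pos: "\<And>x. x \<le> r \<Longrightarrow> 0 < \<pi> x"
  shows "Lambda r \<pi> = weighted_differences_mat r \<pi>"
    and "mat_inv (Lambda r \<pi>) = weighted_sums_mat r \<pi>"
proof -
  note mult = sums_mult_differences[of r \<pi>, OF pos]
  have "transpose_mat (H\<^sub>S r) * mat_diag (r+1) \<pi> = weighted_sums_mat r \<pi>"
    by (subst mat_diag_mult_right[of _ "r+1"])
      (auto simp: H\<^sub>S_def weighted_sums_mat_def intro!: eq_matI)
  then show Lambda: "Lambda r \<pi> = weighted_differences_mat r \<pi>"
    unfolding Lambda_def using mat_inv_eqI[OF weighted_mats_carrier mult] by simp
  show "mat_inv (Lambda r \<pi>) = weighted_sums_mat r \<pi>"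
    unfolding Lambda using weighted_mats_carrier mat_mult_left_right_inverse[OF weighted_mats_carrier mult]
    by (intro mat_inv_eqI)
qed

lemma principal_submatrix_initial:
  assumes A: "A \<in> carrier_mat (r+1) (r+1)" and "0 < r"
  shows "principal_submatrix A {0..r-1} = mat r r (\<lambda>(x, y). A $$ (x, y))"
proof -
  have "{i. i < r + 1 \<and> i \<in> {0..r-1}} = {..<r}" using \<open>0 < r\<close> by auto
  moreover have "pick {0..r-1} i = i" if "i < r" for i
  proof -
    have "{a \<in> {0..r-1}. a < i} = {..<i}" using that by auto
    then show ?thesis using pick_card_in_set[of i "{0..r-1}"] that by auto
  qed
  ultimately show ?thesis
    using A unfolding principal_submatrix_def submatrix_def by (auto intro!: eq_matI)
qed

definition reversal_cdf :: "nat \<Rightarrow> (nat \<Rightarrow> real) \<Rightarrow> (nat \<Rightarrow> nat \<Rightarrow> real) \<Rightarrow> nat \<Rightarrow> nat \<Rightarrow> real" where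
  "reversal_cdf r \<pi> P x y = step_prob {0..r} (time_reversal \<pi> P) x {..y}"

lemma reversal_cdf_eq_sum:
  assumes "y \<le> r"
  shows "reversal_cdf r \<pi> P x y = (\<Sum>z\<le>y. \<pi> z * P z x / \<pi> x)"
proof -
  have "{0..r} \<inter> {..y} = {..y}" using assms by auto
  then show ?thesis by (simp add: reversal_cdf_def step_prob_def time_reversal_def)
qed

text \<open>
  The truncation discards row and column \<open>r\<close>. This does not disturb the product: row \<open>x < r\<close> of
  \<open>\<Lambda>\<^sup>-\<^sup>1\<close> is supported on \<open>{0..x}\<close>, and column \<open>y < r\<close> of \<open>P \<Lambda>\<close> is computed before truncation, where
  column \<open>y + 1\<close> of \<open>P\<close> is still present.
\<close>

lemma truncated_conjugate_entry:
  assumes pos: "\<And>x. x \<le> r \<Longrightarrow> 0 < \<pi> x" and "x < r" "y < r"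
  shows "mat_kernel (principal_submatrix (mat_inv (Lambda r \<pi>)) {0..r-1} *
             principal_submatrix (kernel_mat r P * Lambda r \<pi>) {0..r-1}) x y
         = reversal_cdf r \<pi> P y x - reversal_cdf r \<pi> P (y+1) x"
proof -
  have "0 < r" using \<open>x < r\<close> by simp
  have carrier: "kernel_mat r P * weighted_differences_mat r \<pi> \<in> carrier_mat (r+1) (r+1)"
    using weighted_mats_carrier[of r \<pi>] by (auto simp: kernel_mat_def)
  have Lambda: "Lambda r \<pi> = weighted_differences_mat r \<pi>"
    and inverse: "mat_inv (Lambda r \<pi>) = weighted_sums_mat r \<pi>"
    using Lambda_eq pos by blast+
  have column: "(kernel_mat r P * weighted_differences_mat r \<pi>) $$ (z, y)
      = P z y / \<pi> y - P z (y+1) / \<pi> (y+1)" if "z < r" for z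
  proof -
    have "(kernel_mat r P * weighted_differences_mat r \<pi>) $$ (z, y)
        = (\<Sum>w = 0..<r+1. P z w * ((of_bool (w = y) - of_bool (w = y+1)) / \<pi> w))"
      using \<open>z < r\<close> \<open>y < r\<close>
      by (simp add: kernel_mat_def weighted_differences_mat_def scalar_prod_def)
    also have "\<dots> = (\<Sum>w = 0..<r+1. (if w = y then P z y / \<pi> y else 0)
                                - (if w = y+1 then P z (y+1) / \<pi> (y+1) else 0))"
      by (intro sum.cong) auto
    also have "\<dots> = P z y / \<pi> y - P z (y+1) / \<pi> (y+1)"
      unfolding sum_subtractf using \<open>y < r\<close> by auto
    finally show ?thesis .
  qed
  have "mat_kernel (principal_submatrix (mat_inv (Lambda r \<pi>)) {0..r-1} *
             principal_submatrix (kernel_mat r P * Lambda r \<pi>) {0..r-1}) x y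
      = (\<Sum>z = 0..<r. (if z \<le> x then \<pi> z else 0) * (P z y / \<pi> y - P z (y+1) / \<pi> (y+1)))"
    unfolding inverse unfolding Lambda
      principal_submatrix_initial[OF weighted_mats_carrier(1) \<open>0 < r\<close>]
      principal_submatrix_initial[OF carrier \<open>0 < r\<close>] mat_kernel_def
    using \<open>x < r\<close> \<open>y < r\<close> column
    by (auto simp: scalar_prod_def weighted_sums_mat_def intro!: sum.cong)
  also have "\<dots> = (\<Sum>z\<le>x. \<pi> z * (P z y / \<pi> y - P z (y+1) / \<pi> (y+1)))"
    using \<open>x < r\<close> by (intro sum.mono_neutral_cong_right) auto
  also have "\<dots> = reversal_cdf r \<pi> P y x - reversal_cdf r \<pi> P (y+1) x"
    using \<open>x < r\<close> by (simp add: reversal_cdf_eq_sum sum_subtractf right_diff_distrib)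
  finally show ?thesis .
qed

section \<open>The matrix is an irreducible birth-death kernel\<close>

lemma reversal_cdf_bounds:
  assumes GMC: "GMC r \<pi> P" and "x \<le> r" "y \<le> r"
  shows "0 \<le> reversal_cdf r \<pi> P x y" and "reversal_cdf r \<pi> P x y \<le> 1"
proof -
  have pos: "0 < \<pi> z" if "z \<le> r" for z
    using GMC that by (simp add: GMC_def)
  have nonneg: "0 \<le> \<pi> z * P z x / \<pi> x" if "z \<le> r" for z
  proof -
    have "0 \<le> P z x"
      using GMC that \<open>x \<le> r\<close> by (auto simp: GMC_def markov_kernel_def)
    then show ?thesis
      using pos[OF that] pos[OF \<open>x \<le> r\<close>] by simp
  qed
  have "((\<lambda>z. \<pi> z * P z x) has_sum \<pi> x) {0..r}"
    using GMC \<open>x \<le> r\<close> by (simp add: GMC_def stationary_distribution_def)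
  then have stationary: "(\<Sum>z\<in>{0..r}. \<pi> z * P z x) = \<pi> x"
    using infsumI by fastforce
  show "0 \<le> reversal_cdf r \<pi> P x y"
    unfolding reversal_cdf_eq_sum[OF \<open>y \<le> r\<close>] using nonneg \<open>y \<le> r\<close> by (intro sum_nonneg) auto
  have "reversal_cdf r \<pi> P x y \<le> (\<Sum>z\<in>{0..r}. \<pi> z * P z x / \<pi> x)"
    unfolding reversal_cdf_eq_sum[OF \<open>y \<le> r\<close>] using nonneg \<open>y \<le> r\<close> by (intro sum_mono2) auto
  also have "\<dots> = 1"
    using stationary pos[OF \<open>x \<le> r\<close>] by (simp flip: sum_divide_distrib)
  finally show "reversal_cdf r \<pi> P x y \<le> 1" .
qed

text \<open>
  Each condition of the class fixes the sign of the entries on one diagonal or beyond. In row \<open>x\<close> and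
  column \<open>y\<close> the column is the starting point of the time-reversal, so condition (2) at \<open>y\<close> concerns the
  entry above the diagonal and condition (3) the one below it.
\<close>

lemma GMC_differences:
  assumes GMC: "GMC r \<pi> P"
  defines "D \<equiv> \<lambda>x y. reversal_cdf r \<pi> P y x - reversal_cdf r \<pi> P (y+1) x"
  shows "x < r \<Longrightarrow> 0 \<le> D x x"
    and "x + 1 < r \<Longrightarrow> 0 < D x (x+1)"
    and "x + 1 < r \<Longrightarrow> 0 < D (x+1) x"
    and "x < r \<Longrightarrow> y < r \<Longrightarrow> x \<noteq> y \<Longrightarrow> x \<noteq> y + 1 \<Longrightarrow> y \<noteq> x + 1 \<Longrightarrow> D x y = 0"
proof -
  let ?F = "reversal_cdf r \<pi> P"
  have conds: "\<forall>x\<in>{0..r-1}.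
        ?F (x+1) x \<le> ?F x x \<and>
        (x \<noteq> 0 \<longrightarrow> ?F (x+1) (x-1) < ?F x (x-1)) \<and>
        (x \<noteq> r-1 \<longrightarrow> ?F (x+1) (x+1) < ?F x (x+1)) \<and>
        (\<forall>k\<in>{2..x}. ?F (x+1) (x-k) = ?F x (x-k)) \<and>
        (\<forall>k\<in>{2..r-1-x}. ?F (x+1) (x+k) = ?F x (x+k))"
    using GMC by (simp add: GMC_def reversal_cdf_def Let_def)
  show "0 \<le> D x x" if "x < r"
    using conds that by (simp add: D_def)
  show "0 < D x (x+1)" if "x + 1 < r"
    using bspec[OF conds, of "x+1"] that by (simp add: D_def)
  show "0 < D (x+1) x" if "x + 1 < r"
    using bspec[OF conds, of x] that by (simp add: D_def)
  show "D x y = 0" if "x < r" "y < r" "x \<noteq> y" "x \<noteq> y + 1" "y \<noteq> x + 1"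
  proof (cases "x < y")
    case True
    then have k: "y - x \<in> {2..y}" and x: "y - (y - x) = x" using that by auto
    have "\<forall>k\<in>{2..y}. ?F (y+1) (y-k) = ?F y (y-k)"
      using conds \<open>y < r\<close> by simp
    from bspec[OF this k] show ?thesis by (simp only: D_def x)
  next
    case False
    then have k: "x - y \<in> {2..r-1-y}" and x: "y + (x - y) = x" using that by auto
    have "\<forall>k\<in>{2..r-1-y}. ?F (y+1) (y+k) = ?F y (y+k)"
      using conds \<open>y < r\<close> by simp
    from bspec[OF this k] show ?thesis by (simp only: D_def x)
  qed
qed

lemma birth_death_kernel_if_GMC_differences:
  assumes GMC: "GMC r \<pi> P"
    and K: "\<And>x y. x < r \<Longrightarrow> y < r \<Longrightarrow> K x y = reversal_cdf r \<pi> P y x - reversal_cdf r \<pi> P (y+1) x"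
  shows "birth_death_kernel {0..r-1} K"
proof -
  note D = GMC_differences[OF GMC]
  have "0 < r" using GMC by (simp add: GMC_def)
  then have X: "{0..r-1} = {..<r}" by auto
  have nonneg: "0 \<le> K x y" if "x < r" "y < r" for x y
  proof -
    consider "x = y" | "y = x + 1" | "x = y + 1" | "x \<noteq> y" "x \<noteq> y + 1" "y \<noteq> x + 1" by blast
    then show ?thesis
      by cases (use D(1)[of x] D(2)[of x] D(3)[of y] D(4)[of x y] K[OF that] that in auto)
  qed
  have row_sum: "(\<Sum>y<r. K x y) \<le> 1" if "x < r" for x
  proof -
    have "(\<Sum>y<r. K x y) = reversal_cdf r \<pi> P 0 x - reversal_cdf r \<pi> P r x"
      using that K sum_lessThan_telescope'[of "\<lambda>y. reversal_cdf r \<pi> P y x" r] by simp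
    then show ?thesis
      using reversal_cdf_bounds(2)[OF GMC, of 0 x] reversal_cdf_bounds(1)[OF GMC, of r x] that by simp
  qed
  have band: "y + 1 = x \<or> y = x \<or> y = x + 1" if "x < r" "y < r" "K x y \<noteq> 0" for x y
    using D(4)[of x y] K[of x y] that by auto
  show ?thesis
    unfolding birth_death_kernel_def transition_kernel_def X
    using nonneg row_sum band by (auto intro: summable_on_finite)
qed

theorem theorem3p2:
  fixes r :: nat and P :: "nat \<Rightarrow> nat \<Rightarrow> real" and \<pi> :: "nat \<Rightarrow> real"
  assumes "3 \<le> r" and "GMC r \<pi> P"
  shows "\<exists>Q \<pi>Q. birth_death_kernel {0..r-1} Q \<and>
           irreducible_kernel {0..r-1} Q \<and>
           normal_kernel {0..r-1} Q \<pi>Q \<and>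
           mat_kernel (principal_submatrix (mat_inv (Lambda r \<pi>)) {0..r-1} *
                       principal_submatrix (kernel_mat r P * Lambda r \<pi>) {0..r-1})
             \<in> similarity_orbit {0..r-1} Q \<pi>Q"
proof -
  define K where "K = mat_kernel (principal_submatrix (mat_inv (Lambda r \<pi>)) {0..r-1} *
                       principal_submatrix (kernel_mat r P * Lambda r \<pi>) {0..r-1})"
  define \<mu> where "\<mu> = birth_death_measure K"
  have pos: "0 < \<pi> x" if "x \<le> r" for x
    using \<open>GMC r \<pi> P\<close> that by (simp add: GMC_def)
  have K: "K x y = reversal_cdf r \<pi> P y x - reversal_cdf r \<pi> P (y+1) x" if "x < r" "y < r" for x y
    unfolding K_def using truncated_conjugate_entry pos that by blast
  have up: "0 < K k (k+1)" and down: "0 < K (k+1) k" if "k < r - 1" for k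
    using GMC_differences(2,3)[OF \<open>GMC r \<pi> P\<close>, of k] K that by auto
  have bd: "birth_death_kernel {0..r-1} K"
    using birth_death_kernel_if_GMC_differences[OF \<open>GMC r \<pi> P\<close> K] .
  then have kernel: "transition_kernel {0..r-1} K"
    by (simp add: birth_death_kernel_def)
  have \<mu>_pos: "0 < \<mu> x" if "x \<in> {0..r-1}" for x
    unfolding \<mu>_def using birth_death_measure_pos[of "r-1" K] up down that by auto
  have db: "detailed_balance {0..r-1} K \<mu>"
    unfolding \<mu>_def using detailed_balance_birth_death_measure[OF bd down] .
  have "irreducible_kernel {0..r-1} K"
    by (intro irreducible_if_neighbours_positive up down)
  moreover have "normal_kernel {0..r-1} K \<mu>"
    using normal_kernel_if_detailed_balance[OF _ \<mu>_pos kernel db] by simp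
  moreover have "K \<in> similarity_orbit {0..r-1} K \<mu>"
    using similarity_orbit_refl[OF kernel]
      reference_measure_if_detailed_balance[OF _ \<mu>_pos kernel db] by simp
  ultimately show ?thesis
    using bd unfolding K_def by blast
qed

end
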